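(* Let $a>1$. For every $f\in C_B[0,\infty)$, $x\ge 0$ and $n\in\mathbb{N}$, $$|S_{n,a}^*(f;x)-f(x)|\le 2\,\omega(f,\delta_{n,x}),$$ where $$\delta_{n,x}=\sqrt{\frac{x\left(\left(-1+a^{1/n}\right)^2n^2x-\left(-1+a^{1/n}\right)(-1+2nx)\log a+x(\log a)^2\right)}{\left(-1+a^{1/n}\right)^2n^2}}.$$
   Context: For $a>1$, $n\in\mathbb{N}=\{1,2,\dots\}$ and $x\ge 0$, the operator $S_{n,a}^*$ is defined by $$S_{n,a}^*(f;x)=\sum_{k=0}^{\infty}a^{\left(\frac{-x}{-1+a^{1/n}}\right)}\frac{(x\log a)^k}{(-1+a^{1/n})^k\,k!}\,f\!\left(\frac{k}{n}\right),$$ for functions $f:[0,\infty)\to\mathbb{R}$ for which the series converges ($\log$ is the natural logarithm, and $0^0=1$). $C_B[0,\infty)$ is the space of all continuous bounded real functions on $[0,\infty)$. The modulus of continuity of $f\in C_B[0,\infty)$ is $\omega(f,\delta)=\sup\{|f(t)-f(y)|:\ t,y\in[0,\infty),\ |t-y|\le\delta\}$ for $\delta\ge 0$. (The quantity under the square root equals $S_{n,a}^*((t-x)^2;x)$.) *)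

theory Defs
  imports "HOL-Analysis.Analysis"
begin

text \<open>
  Functions on \<open>[0, \<infinity>)\<close> are represented by total functions \<open>real \<Rightarrow> real\<close>; only their values on
  \<open>{0..}\<close> matter.
\<close>

definition C_B :: "(real \<Rightarrow> real) set" where
  "C_B = {f. continuous_on {0..} f \<and> bounded (f ` {0..})}"

definition S_term :: "nat \<Rightarrow> real \<Rightarrow> (real \<Rightarrow> real) \<Rightarrow> real \<Rightarrow> nat \<Rightarrow> real" where
  "S_term n a f x k =
     a powr (- x / (- 1 + a powr (1 / real n)))
       * ((x * ln a) ^ k / ((- 1 + a powr (1 / real n)) ^ k * fact k))
       * f (real k / real n)"

text \<open>
  The infinite sum is meaningful only if the series converges; \<open>summable_S_term\<close> below shows that
  it does for every function in \<open>C_B\<close>.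
\<close>

definition S_op :: "nat \<Rightarrow> real \<Rightarrow> (real \<Rightarrow> real) \<Rightarrow> real \<Rightarrow> real" where
  "S_op n a f x = (\<Sum>k. S_term n a f x k)"

text \<open>
  The real supremum is meaningful only for nonempty sets that are bounded above; the lemmas
  \<open>modulus_set_nonempty\<close> and \<open>modulus_set_bdd_above\<close> below show that this is the case for functions
  in \<open>C_B\<close> and \<open>\<delta> \<ge> 0\<close>.
\<close>

definition modulus :: "(real \<Rightarrow> real) \<Rightarrow> real \<Rightarrow> real" where
  "modulus f \<delta> = Sup {\<bar>f t - f y\<bar> | t y. t \<in> {0..} \<and> y \<in> {0..} \<and> \<bar>t - y\<bar> \<le> \<delta>}"

definition delta :: "nat \<Rightarrow> real \<Rightarrow> real \<Rightarrow> real" where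
  "delta n a x =
     sqrt (x * ((- 1 + a powr (1 / real n))\<^sup>2 * (real n)\<^sup>2 * x
                - (- 1 + a powr (1 / real n)) * (- 1 + 2 * real n * x) * ln a
                + x * (ln a)\<^sup>2)
           / ((- 1 + a powr (1 / real n))\<^sup>2 * (real n)\<^sup>2))"

lemma summable_S_term:
  assumes "f \<in> C_B"
  shows "summable (S_term n a f x)"
proof -
  obtain B where B: "\<And>t. t \<ge> 0 \<Longrightarrow> \<bar>f t\<bar> \<le> B"
    using assms unfolding C_B_def bounded_iff by auto
  define b where "b = - 1 + a powr (1 / real n)"
  define c where "c = a powr (- x / b)"
  define l where "l = x * ln a / b"
  have t: "S_term n a f x k = c * (l ^ k / fact k) * f (real k / real n)" for k
    by (simp add: S_term_def b_def c_def l_def power_divide)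
  have "summable (\<lambda>k. \<bar>c\<bar> * B * (\<bar>l\<bar> ^ k / fact k))"
    using summable_exp_generic[of "\<bar>l\<bar>"]
    by (intro summable_mult) (simp add: divide_inverse mult.commute)
  moreover have "norm (S_term n a f x k) \<le> \<bar>c\<bar> * B * (\<bar>l\<bar> ^ k / fact k)" for k
  proof -
    have "norm (S_term n a f x k) = \<bar>c\<bar> * (\<bar>l\<bar> ^ k / fact k) * \<bar>f (real k / real n)\<bar>"
      by (simp add: t abs_mult power_abs)
    also have "\<dots> \<le> \<bar>c\<bar> * (\<bar>l\<bar> ^ k / fact k) * B"
      by (intro mult_left_mono B) auto
    finally show ?thesis by (simp add: mult_ac)
  qed
  ultimately show ?thesis by (rule summable_comparison_test'[where N = 0])
qed

lemma modulus_set_nonempty: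
  fixes f :: "real \<Rightarrow> real" and \<delta> :: real
  assumes "\<delta> \<ge> 0"
  shows "{\<bar>f t - f y\<bar> | t y. t \<in> {0..} \<and> y \<in> {0..} \<and> \<bar>t - y\<bar> \<le> \<delta>} \<noteq> {}"
proof -
  have "(0::real) \<in> {0..} \<and> \<bar>0 - 0 :: real\<bar> \<le> \<delta>" using assms by simp
  then show ?thesis by blast
qed

lemma modulus_set_bdd_above:
  assumes "f \<in> C_B"
  shows "bdd_above {\<bar>f t - f y\<bar> | t y. t \<in> {0..} \<and> y \<in> {0..} \<and> \<bar>t - y\<bar> \<le> \<delta>}"
proof -
  obtain B where B: "\<And>t. t \<ge> 0 \<Longrightarrow> \<bar>f t\<bar> \<le> B"
    using assms unfolding C_B_def bounded_iff by auto
  have "\<bar>f t - f y\<bar> \<le> 2 * B" if "t \<ge> 0" "y \<ge> 0" for t y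
    using B[OF that(1)] B[OF that(2)] by linarith
  then show ?thesis by (intro bdd_aboveI[where M = "2 * B"]) auto
qed

end

theory Submission
  imports Defs
begin

text \<open>
  Put \<open>b = a powr (1/n) - 1\<close> and \<open>l = x * ln a / b\<close>. Since \<open>a powr (- x / b) = exp (- l)\<close>, the
  operator averages the values \<open>f (k/n)\<close> against the Poisson distribution of parameter \<open>l\<close>.
  Under it \<open>k/n\<close> has mean \<open>l/n\<close> and variance \<open>l/n\<^sup>2\<close>, so the mean of \<open>(k/n - x)\<^sup>2\<close> is
  \<open>(x - l/n)\<^sup>2 + l/n\<^sup>2\<close>, and expanding shows that this is the square of \<open>delta n a x\<close>.

  The rest is the classical quantitative Korovkin argument: by subadditivity of the modulus of
  continuity, \<open>\<bar>f t - f x\<bar> \<le> (1 + (t - x)\<^sup>2 / \<delta>\<^sup>2) * modulus f \<delta>\<close>; averaging over \<open>t = k/n\<close> turns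
  the right-hand side into \<open>(1 + m / \<delta>\<^sup>2) * modulus f \<delta>\<close> with \<open>m\<close> the second moment about \<open>x\<close>.
  The choice \<open>\<delta> = delta n a x\<close> makes the factor equal to 2. This choice is
  degenerate only for \<open>x = 0\<close>, where the operator reproduces the value of \<open>f\<close>.
\<close>

lemma abs_diff_le_modulus:
  assumes "f \<in> C_B" "t \<ge> 0" "y \<ge> 0" "\<bar>t - y\<bar> \<le> \<delta>"
  shows "\<bar>f t - f y\<bar> \<le> modulus f \<delta>"
  unfolding modulus_def
  by (rule cSup_upper[OF _ modulus_set_bdd_above[OF assms(1)]]) (use assms in auto)

lemma modulus_nonneg:
  assumes "f \<in> C_B" "\<delta> \<ge> 0"
  shows "0 \<le> modulus f \<delta>"
  using abs_diff_le_modulus[OF assms(1), of 0 0 \<delta>] assms(2) by simp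

text \<open>Walk from \<open>y\<close> to \<open>t\<close> in \<open>m\<close> equal steps, each of length at most \<open>\<delta>\<close>.\<close>

lemma abs_diff_le_multiple_modulus:
  assumes "f \<in> C_B" "t \<ge> 0" "y \<ge> 0" "\<bar>t - y\<bar> \<le> real m * \<delta>"
  shows "\<bar>f t - f y\<bar> \<le> real m * modulus f \<delta>"
  using assms(3,4)
proof (induction m arbitrary: y)
  case 0
  then show ?case by simp
next
  case (Suc m)
  \<comment> \<open>The first point of the walk; as a convex combination of \<open>y\<close> and \<open>t\<close> it stays in the domain.\<close>
  define z where "z = y + (t - y) / real (Suc m)"
  have "z = (real m * y + t) / real (Suc m)"
    by (simp add: z_def field_simps)
  then have z: "z \<ge> 0" using Suc.prems assms(2) by simp
  have "\<bar>z - y\<bar> = \<bar>t - y\<bar> / real (Suc m)" by (simp add: z_def)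
  also have "\<dots> \<le> \<delta>" using Suc.prems(2) by (simp add: divide_le_eq mult.commute)
  finally have step: "\<bar>f z - f y\<bar> \<le> modulus f \<delta>" "\<bar>z - y\<bar> \<le> \<delta>"
    using abs_diff_le_modulus[OF assms(1) z Suc.prems(1)] by auto
  have "t - z = real m * (z - y)" by (simp add: z_def field_simps)
  then have "\<bar>t - z\<bar> \<le> real m * \<delta>"
    using step(2) by (simp add: abs_mult mult_left_mono)
  from Suc.IH[OF z this] step(1) show ?case by (simp add: algebra_simps)
qed

text \<open>
  Outside the \<open>\<delta>\<close>-neighbourhood of \<open>y\<close> the number of steps needed is at most
  \<open>1 + \<bar>t - y\<bar> / \<delta>\<close>, and there \<open>\<bar>t - y\<bar> / \<delta>\<close> is bounded by its square. The quadratic form of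
  the bound makes it possible to average it using only second moments.
\<close>

lemma abs_diff_le_quadratic_modulus:
  assumes "f \<in> C_B" "t \<ge> 0" "y \<ge> 0" "\<delta> > 0"
  shows "\<bar>f t - f y\<bar> \<le> (1 + (t - y)\<^sup>2 / \<delta>\<^sup>2) * modulus f \<delta>"
proof (cases "\<bar>t - y\<bar> \<le> \<delta>")
  case True
  have "\<bar>f t - f y\<bar> \<le> 1 * modulus f \<delta>"
    using abs_diff_le_modulus[OF assms(1-3) True] by simp
  also have "\<dots> \<le> (1 + (t - y)\<^sup>2 / \<delta>\<^sup>2) * modulus f \<delta>"
    using modulus_nonneg[OF assms(1)] assms(4) by (intro mult_right_mono) auto
  finally show ?thesis .
next
  case False
  define r where "r = \<bar>t - y\<bar> / \<delta>"
  have r: "1 \<le> r" "r\<^sup>2 = (t - y)\<^sup>2 / \<delta>\<^sup>2"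
    using False assms(4) by (auto simp: r_def field_simps power_divide)
  define m where "m = nat \<lceil>r\<rceil>"
  have m: "r \<le> real m" "real m \<le> 1 + r"
    using r(1) unfolding m_def by linarith+
  have "\<bar>t - y\<bar> = r * \<delta>" using assms(4) by (simp add: r_def)
  also have "\<dots> \<le> real m * \<delta>" using m(1) assms(4) by (intro mult_right_mono) auto
  finally have "\<bar>f t - f y\<bar> \<le> real m * modulus f \<delta>"
    by (rule abs_diff_le_multiple_modulus[OF assms(1-3)])
  also have "\<dots> \<le> (1 + r\<^sup>2) * modulus f \<delta>"
  proof (rule mult_right_mono)
    have "r \<le> r\<^sup>2" using r(1) self_le_power[of r 2] by simp
    then show "real m \<le> 1 + r\<^sup>2" using m(2) by linarith
  qed (use modulus_nonneg[OF assms(1)] assms(4) in simp)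
  finally show ?thesis by (simp only: r(2))
qed

definition poisson_weight :: "real \<Rightarrow> nat \<Rightarrow> real" where
  "poisson_weight l k = exp (- l) * (l ^ k / fact k)"

lemma poisson_weight_nonneg: "l \<ge> 0 \<Longrightarrow> poisson_weight l k \<ge> 0"
  by (simp add: poisson_weight_def)

lemma poisson_weight_Suc: "real (Suc k) * poisson_weight l (Suc k) = l * poisson_weight l k"
  unfolding poisson_weight_def by (simp add: field_simps del: of_nat_Suc)

lemma poisson_weight_sums: "poisson_weight l sums 1"
proof -
  have "(\<lambda>k. exp (- l) * (l ^ k / fact k)) sums (exp (- l) * exp l)"
    using exp_converges[of l] by (intro sums_mult) (simp add: divide_inverse mult.commute)
  then show ?thesis by (simp add: poisson_weight_def[abs_def] exp_minus)
qed

lemma poisson_mean_sums: "(\<lambda>k. real k * poisson_weight l k) sums l"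
proof -
  have "(\<lambda>k. real (Suc k) * poisson_weight l (Suc k)) sums l"
    using sums_mult[OF poisson_weight_sums, of l l] by (simp only: poisson_weight_Suc) simp
  then show ?thesis by (subst (asm) sums_Suc_iff) simp
qed

lemma poisson_square_sums: "(\<lambda>k. (real k)\<^sup>2 * poisson_weight l k) sums (l\<^sup>2 + l)"
proof -
  have "(real (Suc k))\<^sup>2 * poisson_weight l (Suc k)
      = l * (real k * poisson_weight l k) + l * poisson_weight l k" for k
  proof -
    have "(real (Suc k))\<^sup>2 * poisson_weight l (Suc k) = real (Suc k) * (l * poisson_weight l k)"
      by (simp only: poisson_weight_Suc[symmetric] power2_eq_square mult.assoc)
    then show ?thesis by (simp add: algebra_simps)
  qed
  moreover have "(\<lambda>k. l * (real k * poisson_weight l k) + l * poisson_weight l k) sums (l * l + l * 1)"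
    by (intro sums_add sums_mult poisson_mean_sums poisson_weight_sums)
  ultimately have "(\<lambda>k. (real (Suc k))\<^sup>2 * poisson_weight l (Suc k)) sums (l\<^sup>2 + l)"
    by (simp only: power2_eq_square mult_1_right)
  then show ?thesis by (subst (asm) sums_Suc_iff) simp
qed

text \<open>Variance plus squared bias, for the rescaled variable \<open>k/n\<close>.\<close>

lemma poisson_scaled_second_moment_sums:
  fixes n :: nat
  assumes "n > 0"
  shows "(\<lambda>k. poisson_weight l k * (real k / real n - x)\<^sup>2) sums ((x - l / n)\<^sup>2 + l / n\<^sup>2)"
proof -
  have "(\<lambda>k. 1 / n\<^sup>2 * ((real k)\<^sup>2 * poisson_weight l k) + (- (2 * x / n)) * (real k * poisson_weight l k)
          + x\<^sup>2 * poisson_weight l k) sums (1 / n\<^sup>2 * (l\<^sup>2 + l) + (- (2 * x / n)) * l + x\<^sup>2 * 1)"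
    by (intro sums_add sums_mult poisson_square_sums poisson_mean_sums poisson_weight_sums)
  moreover have "1 / n\<^sup>2 * (l\<^sup>2 + l) + (- (2 * x / n)) * l + x\<^sup>2 * 1 = (x - l / n)\<^sup>2 + l / n\<^sup>2"
    using assms by (simp add: field_simps power2_eq_square)
  moreover have "1 / n\<^sup>2 * ((real k)\<^sup>2 * w) + (- (2 * x / n)) * (real k * w) + x\<^sup>2 * w
      = w * (real k / real n - x)\<^sup>2" for k w
    using assms by (simp add: field_simps power2_eq_square)
  ultimately show ?thesis by simp
qed

lemma S_term_poisson:
  assumes "a > 1"
  shows "S_term n a f x k
    = poisson_weight (x * ln a / (- 1 + a powr (1 / real n))) k * f (real k / real n)"
proof -
  have "a powr (- x / (- 1 + a powr (1 / real n)))
      = exp (- (x * ln a / (- 1 + a powr (1 / real n))))"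
    using assms unfolding powr_def by simp
  then show ?thesis by (simp add: S_term_def poisson_weight_def power_divide)
qed

lemma delta_eq_poisson_second_moment:
  fixes a x :: real and n :: nat
  assumes "a > 1" "n > 0"
  defines "l \<equiv> x * ln a / (- 1 + a powr (1 / real n))"
  shows "delta n a x = sqrt ((x - l / n)\<^sup>2 + l / n\<^sup>2)"
proof -
  have alg: "x * (b\<^sup>2 * N\<^sup>2 * x - b * (- 1 + 2 * N * x) * c + x * c\<^sup>2) / (b\<^sup>2 * N\<^sup>2)
      = (x - (x * c / b) / N)\<^sup>2 + (x * c / b) / N\<^sup>2" if "b \<noteq> 0" "N \<noteq> 0" for b c N :: real
    using that by (simp add: field_simps power2_eq_square)
  have "a powr (1 / real n) > 1" using assms by simp
  then show ?thesis unfolding delta_def l_def using assms(2) by (subst alg) auto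
qed

text \<open>
  The averaging step. The difference is the mean of \<open>f (k/n) - f x\<close> because the weights add up
  to 1, and \<open>\<delta>\<^sup>2\<close> being exactly the second moment, the quadratic bound has mean 2.
\<close>

lemma poisson_average_deviation:
  fixes n :: nat
  assumes f: "f \<in> C_B" and "l \<ge> 0" "x \<ge> 0" "n > 0" "\<delta> > 0"
    and \<delta>: "\<delta>\<^sup>2 = (x - l / n)\<^sup>2 + l / n\<^sup>2"
    and S: "(\<lambda>k. poisson_weight l k * f (real k / real n)) sums S"
  shows "\<bar>S - f x\<bar> \<le> 2 * modulus f \<delta>"
proof -
  let ?w = "poisson_weight l" and ?M = "modulus f \<delta>"
  define u where "u k = ?w k * (f (real k / real n) - f x)" for k
  define v where "v k = ?M * ?w k + ?M / \<delta>\<^sup>2 * (?w k * (real k / real n - x)\<^sup>2)" for k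
  have u: "u sums (S - f x)"
    using sums_diff[OF S sums_mult[OF poisson_weight_sums, of "f x" l]]
    by (simp add: u_def[abs_def] algebra_simps)
  have "v sums (?M * 1 + ?M / \<delta>\<^sup>2 * \<delta>\<^sup>2)"
    unfolding v_def \<delta>
    by (intro sums_add sums_mult poisson_weight_sums poisson_scaled_second_moment_sums assms)
  then have v: "v sums (2 * ?M)" using \<open>\<delta> > 0\<close> by simp
  have uv: "norm (u k) \<le> v k" for k
  proof -
    have "\<bar>f (real k / real n) - f x\<bar> \<le> (1 + (real k / real n - x)\<^sup>2 / \<delta>\<^sup>2) * ?M"
      by (rule abs_diff_le_quadratic_modulus) (use assms in auto)
    from mult_left_mono[OF this poisson_weight_nonneg[OF \<open>l \<ge> 0\<close>, of k]]
    have "?w k * \<bar>f (real k / real n) - f x\<bar> \<le> v k"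
      by (simp add: v_def algebra_simps)
    then show ?thesis
      using poisson_weight_nonneg[OF \<open>l \<ge> 0\<close>, of k] by (simp add: u_def abs_mult)
  qed
  have "S - f x \<le> 2 * ?M" "- (S - f x) \<le> 2 * ?M"
    using sums_le[OF _ u v] sums_le[OF _ sums_minus[OF u] v] uv by (auto simp: abs_le_iff)
  then show ?thesis by linarith
qed

theorem theorem5p1:
  fixes a x :: real and n :: nat and f :: "real \<Rightarrow> real"
  assumes "a > 1" and "f \<in> C_B" and "x \<ge> 0" and "n \<ge> 1"
  shows "\<bar>S_op n a f x - f x\<bar> \<le> 2 * modulus f (delta n a x)"
proof -
  define l where "l = x * ln a / (- 1 + a powr (1 / real n))"
  have n: "n > 0" using assms(4) by simp
  have b: "a powr (1 / real n) > 1" using assms(1) n by simp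
  have l: "l \<ge> 0" using less_imp_le[OF b] assms(1,3) by (simp add: l_def)
  have S: "(\<lambda>k. poisson_weight l k * f (real k / real n)) sums S_op n a f x"
    using summable_sums[OF summable_S_term[OF assms(2), of n a x]]
    unfolding S_op_def l_def S_term_poisson[OF assms(1), symmetric] .
  have delta: "delta n a x = sqrt ((x - l / n)\<^sup>2 + l / n\<^sup>2)"
    unfolding l_def by (rule delta_eq_poisson_second_moment[OF assms(1) n])
  show ?thesis
  proof (cases "x = 0")
    case True
    \<comment> \<open>The Poisson distribution of parameter 0 is concentrated at \<open>k = 0\<close>.\<close>
    then have "poisson_weight l k * f (real k / real n) = (if k = 0 then f x else 0)" for k
      by (simp add: l_def poisson_weight_def)
    with S have "(\<lambda>k. if k = 0 then f x else 0) sums S_op n a f x" by simp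
    then have "S_op n a f x = f x"
      using sums_single[of 0 "\<lambda>_. f x"] by (simp add: sums_iff)
    then show ?thesis using modulus_nonneg[OF assms(2)] by (simp add: delta l)
  next
    case False
    then have "l > 0" using b assms by (simp add: l_def)
    then have pos: "(x - l / n)\<^sup>2 + l / n\<^sup>2 > 0"
      using n by (intro add_nonneg_pos) auto
    show ?thesis
      by (rule poisson_average_deviation[OF assms(2) l assms(3) n _ _ S])
        (use pos in \<open>simp_all add: delta\<close>)
  qed
qed

end
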